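(* Let $k>0$ be real, let $\alpha,\beta,\beta',\gamma\in\mathbb{C}$ with $\gamma\notin\{0,-k,-2k,\dots\}$, and let $x,y\in\mathbb{C}$ with $|x|<\frac1k$, $|y|<\frac1k$ and $\left|\frac{y}{1-ky}\right|<\frac1k$. Then $$F_{1,k}(\alpha,\beta,\beta';\gamma;x,y)=(1-ky)^{-\frac{\beta'}{k}}F_{3,k}\left(\alpha,\gamma-\alpha,\beta,\beta';\gamma;x,-\frac{y}{1-ky}\right).$$
   Context: For real $k>0$, $a\in\mathbb{C}$ and an integer $n\ge 1$, the Pochhammer $k$-symbol is $(a)_{n,k}=a(a+k)(a+2k)\cdots(a+(n-1)k)$, and $(a)_{0,k}=1$. The Appell $k$-functions $F_{1,k}$ and $F_{3,k}$ are $$F_{1,k}(\alpha,\beta,\beta';\gamma;x,y)=\sum_{m,n=0}^\infty\frac{(\alpha)_{m+n,k}(\beta)_{m,k}(\beta')_{n,k}}{(\gamma)_{m+n,k}}\frac{x^m}{m!}\frac{y^n}{n!},\qquad |x|<\tfrac1k,\ |y|<\tfrac1k,$$ $$F_{3,k}(\alpha,\alpha',\beta,\beta';\gamma;x,y)=\sum_{m,n=0}^\infty\frac{(\alpha)_{m,k}(\alpha')_{n,k}(\beta)_{m,k}(\beta')_{n,k}}{(\gamma)_{m+n,k}}\frac{x^m}{m!}\frac{y^n}{n!},\qquad |x|<\tfrac1k,\ |y|<\tfrac1k.$$ Complex powers are principal values. *)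

theory Defs
  imports "HOL-Analysis.Analysis"
begin

definition k_pochhammer :: "real \<Rightarrow> complex \<Rightarrow> nat \<Rightarrow> complex" where
  "k_pochhammer k a n = (\<Prod>i<n. a + of_nat i * of_real k)"

text \<open>
  The double series are unordered sums over all pairs \<open>(m, n)\<close>; in the complex numbers such a
  sum exists iff it converges absolutely. This is the case whenever \<open>k > 0\<close>,
  \<open>norm x < 1 / k\<close>, \<open>norm y < 1 / k\<close> and \<open>\<gamma>\<close> is none of \<open>0, -k, -2k, \<dots>\<close>; outside that
  range the values of the functions below carry no meaning.
\<close>

definition appell_F1 ::
  "real \<Rightarrow> complex \<Rightarrow> complex \<Rightarrow> complex \<Rightarrow> complex \<Rightarrow> complex \<Rightarrow> complex \<Rightarrow> complex" where
  "appell_F1 k \<alpha> \<beta> \<beta>' \<gamma> x y =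
     (\<Sum>\<^sub>\<infinity>(m, n)\<in>UNIV.
        k_pochhammer k \<alpha> (m + n) * k_pochhammer k \<beta> m * k_pochhammer k \<beta>' n
          / k_pochhammer k \<gamma> (m + n) * (x ^ m / fact m) * (y ^ n / fact n))"

definition appell_F3 ::
  "real \<Rightarrow> complex \<Rightarrow> complex \<Rightarrow> complex \<Rightarrow> complex \<Rightarrow> complex \<Rightarrow> complex \<Rightarrow> complex \<Rightarrow> complex" where
  "appell_F3 k \<alpha> \<alpha>' \<beta> \<beta>' \<gamma> x y =
     (\<Sum>\<^sub>\<infinity>(m, n)\<in>UNIV.
        k_pochhammer k \<alpha> m * k_pochhammer k \<alpha>' n * k_pochhammer k \<beta> m * k_pochhammer k \<beta>' n
          / k_pochhammer k \<gamma> (m + n) * (x ^ m / fact m) * (y ^ n / fact n))"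

end

theory Submission
  imports Defs "HOL-Complex_Analysis.Complex_Analysis"
begin

text \<open>
  After replacing the parameters by their quotients by \<open>k\<close> and the variables by their multiples by
  \<open>k\<close>, one may assume \<open>k = 1\<close> (lemmas \<open>appell_F1_rescale\<close> and \<open>appell_F3_rescale\<close>). For fixed \<open>m\<close>,
  the sum over \<open>n\<close> in \<open>F\<^sub>1\<close> is a multiple of the Gauss series \<open>\<^sub>2F\<^sub>1(\<alpha> + m, \<beta>'; \<gamma> + m; y)\<close>, and the
  sum over \<open>n\<close> in \<open>F\<^sub>3\<close> is the same multiple of \<open>\<^sub>2F\<^sub>1(\<gamma> - \<alpha>, \<beta>'; \<gamma> + m; w)\<close> with \<open>w = -y / (1 - y)\<close>
  (lemmas \<open>appell_F1_rows\<close> and \<open>appell_F3_rows\<close>). Pfaff's transformation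
  \<open>\<^sub>2F\<^sub>1(a, b; c; y) = (1 - y)\<^sup>-\<^sup>b \<^sub>2F\<^sub>1(c - a, b; c; w)\<close> with \<open>a = \<alpha> + m\<close>, \<open>b = \<beta>'\<close>, \<open>c = \<gamma> + m\<close> identifies
  the rows up to the factor \<open>(1 - y)\<^sup>-\<^sup>b\<close>, which is independent of \<open>m\<close>.

  Pfaff's transformation itself is obtained near \<open>0\<close> by rearranging a double series and using the
  Chu--Vandermonde identity, and is then extended by analytic continuation to all \<open>y\<close> with
  \<open>norm y < 1\<close> and \<open>norm w < 1\<close> (lemma \<open>Pfaff_transformation\<close>). Every interchange of summations
  rests on the bound \<open>pochhammer_ratio_bound\<close>.
\<close>

section \<open>Growth of Pochhammer quotients and double series\<close>

text \<open>
  The quotient grows only polynomially, but a bound by \<open>C r\<^sup>n\<close> for every \<open>r > 1\<close> is enough for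
  convergence inside the unit disc, and it is easier to get: consecutive quotients differ by the
  factor \<open>(a + n) / (c + n)\<close>, which tends to \<open>1\<close>.
\<close>

lemma pochhammer_ratio_bound:
  fixes a c :: complex and r :: real
  assumes c: "c \<notin> \<int>\<^sub>\<le>\<^sub>0" and r: "r > 1"
  obtains C where "C \<ge> 0" "\<And>n. norm (pochhammer a n / pochhammer c n) \<le> C * r ^ n"
proof -
  define f where "f n = pochhammer a n / pochhammer c n / of_real r ^ n" for n
  have c_nz: "c + of_nat n \<noteq> 0" for n
    using c plus_of_nat_eq_0_imp by blast
  \<comment> \<open>\<open>f\<close> is the quotient divided by \<open>r\<^sup>n\<close>; its ratios tend to \<open>1 / r < 1\<close>, so its terms even tend to zero.\<close>
  have f_Suc: "norm (f (Suc n)) = norm ((a + of_nat n) / (c + of_nat n)) / r * norm (f n)" for n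
    using r by (simp add: f_def pochhammer_Suc norm_mult norm_divide norm_power norm_inverse divide_inverse mult_ac)
  have "(\<lambda>n. (a + of_nat n) / (c + of_nat n)) \<longlonglongrightarrow> 1"
  proof -
    have "(\<lambda>n. 1 + (a - c) * inverse (c + of_nat n)) \<longlonglongrightarrow> 1 + (a - c) * 0"
      by (intro tendsto_intros tendsto_inverse_0[THEN filterlim_compose]
            tendsto_add_filterlim_at_infinity[OF tendsto_const] tendsto_of_nat)
    moreover have "1 + (a - c) * inverse (c + of_nat n) = (a + of_nat n) / (c + of_nat n)" for n
      using c_nz[of n] by (simp add: field_simps)
    ultimately show ?thesis by simp
  qed
  then have "(\<lambda>n. norm ((a + of_nat n) / (c + of_nat n)) / r) \<longlonglongrightarrow> norm (1::complex) / r"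
    using r by (intro tendsto_intros) auto
  moreover have "norm (1::complex) / r < (1 + 1 / r) / 2"
    using r by (simp add: field_simps)
  ultimately have "\<forall>\<^sub>F n in sequentially. norm ((a + of_nat n) / (c + of_nat n)) / r < (1 + 1 / r) / 2"
    by (rule order_tendstoD)
  then obtain N where N: "\<And>n. n \<ge> N \<Longrightarrow> norm ((a + of_nat n) / (c + of_nat n)) / r < (1 + 1 / r) / 2"
    by (auto simp: eventually_sequentially)
  have "summable f"
  proof (rule summable_ratio_test)
    show "(1 + 1 / r) / 2 < 1" using r by (simp add: field_simps)
    show "norm (f (Suc n)) \<le> (1 + 1 / r) / 2 * norm (f n)" if "n \<ge> N" for n
      unfolding f_Suc using N[OF that] by (intro mult_right_mono) auto
  qed
  then have "Bseq f"
    by (intro convergent_imp_Bseq convergentI[OF summable_LIMSEQ_zero])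
  then obtain C where C: "C > 0" "\<And>n. norm (f n) \<le> C"
    unfolding Bseq_def by blast
  show thesis
  proof (rule that[of C])
    fix n
    have "norm (pochhammer a n / pochhammer c n) = norm (f n) * r ^ n"
      using r by (simp add: f_def norm_divide norm_mult norm_power)
    also have "\<dots> \<le> C * r ^ n"
      using C r by (intro mult_right_mono) auto
    finally show "norm (pochhammer a n / pochhammer c n) \<le> C * r ^ n" .
  qed (use C in auto)
qed

lemma pochhammer_over_fact_bound:
  fixes a :: complex and r :: real
  assumes "r > 1"
  obtains C where "C \<ge> 0" "\<And>n. norm (pochhammer a n / fact n) \<le> C * r ^ n"
proof -
  obtain C where "C \<ge> 0" "\<And>n. norm (pochhammer a n / pochhammer 1 n) \<le> C * r ^ n"
    by (rule pochhammer_ratio_bound[OF one_notin_nonpos_Ints assms]) (rule that)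
  then show thesis
    using that unfolding pochhammer_fact by blast
qed

text \<open>
  A term built from \<open>d\<close> Pochhammer quotients is at most a constant times \<open>(r\<^sup>d q)\<^sup>n\<close>. Taking \<open>r\<close>
  close enough to \<open>1\<close> turns this into a convergent geometric series.
\<close>

lemma exists_radius_power_mult_less_1:
  fixes q :: real
  assumes "q < 1"
  obtains r where "r > 1" "r ^ d * q < 1"
proof -
  have "((\<lambda>r. r ^ d * q) \<longlongrightarrow> 1 ^ d * q) (at_right 1)"
    by (intro tendsto_intros)
  then have "\<forall>\<^sub>F r in at_right 1. r ^ d * q < 1"
    using assms by (intro order_tendstoD(2)) auto
  moreover have "\<forall>\<^sub>F r in at_right (1::real). r > 1"
    by (simp add: eventually_at_right_less)
  ultimately have "\<forall>\<^sub>F r in at_right 1. r > 1 \<and> r ^ d * q < 1"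
    by eventually_elim auto
  then obtain r where "r > 1 \<and> r ^ d * q < 1"
    using eventually_happens'[OF trivial_limit_at_right_real] by blast
  then show thesis
    using that by blast
qed

lemma summable_on_geometric_bound:
  fixes f :: "nat \<times> nat \<Rightarrow> complex"
  assumes bound: "\<And>m n. norm (f (m, n)) \<le> C * p ^ m * q ^ n"
    and "0 \<le> p" "p < 1" "0 \<le> q" "q < 1" "0 \<le> C"
  shows "f summable_on UNIV \<times> UNIV"
proof (rule abs_summable_summable, rule Infinite_Sum.abs_summable_on_comparison_test[where g = "\<lambda>(m, n). C * p ^ m * q ^ n"])
  have row: "((\<lambda>n. C * p ^ m * q ^ n) has_sum (C * p ^ m * (1 / (1 - q)))) UNIV" for m
    using assms by (intro sums_nonneg_imp_has_sum sums_mult geometric_sums) auto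
  have "((\<lambda>m. C * p ^ m * (1 / (1 - q))) has_sum (C * (1 / (1 - p)) * (1 / (1 - q)))) UNIV"
    using assms by (intro sums_nonneg_imp_has_sum sums_mult sums_mult2 geometric_sums) auto
  then have "(\<lambda>(m, n). C * p ^ m * q ^ n) summable_on UNIV \<times> UNIV"
    using row assms by (intro summable_on_SigmaI[where g = "\<lambda>m. C * p ^ m * (1 / (1 - q))"])
      (auto intro: has_sum_imp_summable)
  moreover have "norm (case x of (m, n) \<Rightarrow> C * p ^ m * q ^ n) = (case x of (m, n) \<Rightarrow> C * p ^ m * q ^ n)" for x
    using assms by (simp split: prod.splits)
  ultimately show "(\<lambda>x. norm (case x of (m, n) \<Rightarrow> C * p ^ m * q ^ n)) summable_on UNIV \<times> UNIV"
    by simp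
  show "norm (f x) \<le> norm (case x of (m, n) \<Rightarrow> C * p ^ m * q ^ n)" for x
    using bound[of "fst x" "snd x"] assms by (simp split: prod.splits)
qed

section \<open>The Gauss hypergeometric series and Pfaff's transformation\<close>

definition hypergeometric_2F1 :: "complex \<Rightarrow> complex \<Rightarrow> complex \<Rightarrow> complex \<Rightarrow> complex" where
  "hypergeometric_2F1 a b c z =
     (\<Sum>n. pochhammer a n * pochhammer b n / (pochhammer c n * fact n) * z ^ n)"

lemma summable_norm_hypergeometric_2F1:
  fixes a b c z :: complex
  assumes c: "c \<notin> \<int>\<^sub>\<le>\<^sub>0" and z: "norm z < 1"
  shows "summable (\<lambda>n. norm (pochhammer a n * pochhammer b n / (pochhammer c n * fact n) * z ^ n))"
proof -
  obtain r where r: "r > 1" "r ^ 2 * norm z < 1"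
    using exists_radius_power_mult_less_1[OF z] .
  obtain C where C: "C \<ge> 0" "\<And>n. norm (pochhammer a n / pochhammer c n) \<le> C * r ^ n"
    by (rule pochhammer_ratio_bound[OF c r(1)]) (rule that)
  obtain B where B: "B \<ge> 0" "\<And>n. norm (pochhammer b n / fact n) \<le> B * r ^ n"
    by (rule pochhammer_over_fact_bound[OF r(1)]) (rule that)
  show ?thesis
  proof (rule summable_comparison_test)
    show "summable (\<lambda>n. (C * B) * (r ^ 2 * norm z) ^ n)"
      using r by (intro summable_mult summable_geometric) auto
    have "norm (pochhammer a n * pochhammer b n / (pochhammer c n * fact n) * z ^ n)
        \<le> (C * B) * (r ^ 2 * norm z) ^ n" for n
    proof -
      have "norm (pochhammer a n * pochhammer b n / (pochhammer c n * fact n) * z ^ n)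
          = norm (pochhammer a n / pochhammer c n) * norm (pochhammer b n / fact n) * norm z ^ n"
        by (simp add: norm_mult norm_divide norm_power)
      also have "\<dots> \<le> (C * r ^ n) * (B * r ^ n) * norm z ^ n"
        using B C r by (intro mult_mono) auto
      finally show ?thesis
        by (simp add: power_mult_distrib power2_eq_square mult_ac)
    qed
    then show "\<exists>N. \<forall>n\<ge>N. norm (norm (pochhammer a n * pochhammer b n / (pochhammer c n * fact n) * z ^ n))
        \<le> (C * B) * (r ^ 2 * norm z) ^ n"
      by auto
  qed
qed

lemma sums_hypergeometric_2F1:
  assumes "c \<notin> \<int>\<^sub>\<le>\<^sub>0" "norm z < 1"
  shows "(\<lambda>n. pochhammer a n * pochhammer b n / (pochhammer c n * fact n) * z ^ n)
           sums hypergeometric_2F1 a b c z"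
  unfolding hypergeometric_2F1_def
  by (rule summable_sums[OF summable_norm_cancel[OF summable_norm_hypergeometric_2F1[OF assms]]])

lemma has_sum_hypergeometric_2F1:
  assumes "c \<notin> \<int>\<^sub>\<le>\<^sub>0" "norm z < 1"
  shows "((\<lambda>n. pochhammer a n * pochhammer b n / (pochhammer c n * fact n) * z ^ n)
           has_sum hypergeometric_2F1 a b c z) UNIV"
  by (rule norm_summable_imp_has_sum[OF summable_norm_hypergeometric_2F1[OF assms]
        sums_hypergeometric_2F1[OF assms]])

lemma holomorphic_hypergeometric_2F1:
  assumes "c \<notin> \<int>\<^sub>\<le>\<^sub>0"
  shows "hypergeometric_2F1 a b c holomorphic_on ball 0 1"
proof (rule power_series_holomorphic)
  show "(\<lambda>n. pochhammer a n * pochhammer b n / (pochhammer c n * fact n) * (w - 0) ^ n)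
          sums hypergeometric_2F1 a b c w" if "w \<in> ball 0 1" for w
    using sums_hypergeometric_2F1[OF assms, of w a b] that by simp
qed

lemma has_sum_binomial_series:
  fixes z b :: complex
  assumes "norm z < 1"
  shows "((\<lambda>n. pochhammer b n / fact n * z ^ n) has_sum (1 - z) powr (- b)) UNIV"
proof (rule norm_summable_imp_has_sum)
  have "(\<lambda>n. (-b gchoose n) * (-z) ^ n) sums (1 + -z) powr (-b)"
    by (rule gen_binomial_complex) (use assms in auto)
  also have "(\<lambda>n. (-b gchoose n) * (-z) ^ n) = (\<lambda>n. pochhammer b n / fact n * z ^ n)"
  proof
    show "(-b gchoose n) * (-z) ^ n = pochhammer b n / fact n * z ^ n" for n
      by (cases "even n") (simp_all add: gbinomial_pochhammer)
  qed
  finally show "(\<lambda>n. pochhammer b n / fact n * z ^ n) sums (1 - z) powr (- b)"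
    by simp
  show "summable (\<lambda>n. norm (pochhammer b n / fact n * z ^ n))"
    using summable_norm_hypergeometric_2F1[of 1 z 1 b] assms by (simp flip: pochhammer_fact)
qed

lemma pochhammer_minus_of_nat:
  assumes "n \<le> N"
  shows "pochhammer (- of_nat N :: complex) n = (-1) ^ n * fact N / fact (N - n)"
proof -
  have "of_nat N - of_nat n + 1 = (1 + of_nat (N - n) :: complex)"
    using assms by (simp add: of_nat_diff)
  moreover have "fact N = fact (N - n) * pochhammer (1 + of_nat (N - n) :: complex) n"
    using pochhammer_product'[of "1::complex" "N - n" n] assms by (simp flip: pochhammer_fact)
  ultimately show ?thesis
    by (simp add: pochhammer_minus add.commute)
qed

text \<open>
  Since \<open>(-1)\<^sup>n N! / (N - n)!\<close> is the Pochhammer symbol of \<open>-N\<close>, the sum is the terminating series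
  \<open>\<^sub>2F\<^sub>1(c - a, -N; c; 1)\<close> divided by \<open>N!\<close>, and the Chu--Vandermonde identity evaluates it.
\<close>

lemma sum_Vandermonde_binomial:
  fixes a c :: complex
  assumes c: "c \<notin> \<int>\<^sub>\<le>\<^sub>0"
  shows "(\<Sum>n\<le>N. pochhammer (c - a) n / pochhammer c n * (-1) ^ n / (fact n * fact (N - n)))
           = pochhammer a N / (pochhammer c N * fact N)"
proof -
  have "(\<Sum>n\<le>N. pochhammer (c - a) n / pochhammer c n * (-1) ^ n / (fact n * fact (N - n)))
      = (\<Sum>n\<le>N. pochhammer (c - a) n * pochhammer (- of_nat N) n / (of_nat (fact n) * pochhammer c n)) / fact N"
    unfolding sum_divide_distrib
    by (intro sum.cong refl) (simp add: pochhammer_minus_of_nat)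
  also have "(\<Sum>n\<le>N. pochhammer (c - a) n * pochhammer (- of_nat N) n / (of_nat (fact n) * pochhammer c n))
      = pochhammer a N / pochhammer c N"
    using Vandermonde_pochhammer[of N c "c - a"] c by (force simp: atMost_atLeast0)
  finally show ?thesis by simp
qed

text \<open>
  Expand every power \<open>(1 - z)\<close> to \<open>-b - n\<close> on the right-hand side by the binomial series. This
  gives a double series over \<open>(n, j)\<close> in the monomials \<open>z\<^sup>n\<^sup>+\<^sup>j\<close>; summing along the diagonals
  \<open>n + j = N\<close> instead of the rows leaves, by Chu--Vandermonde, the coefficient of \<open>z\<^sup>N\<close> in
  \<open>\<^sub>2F\<^sub>1(a, b; c; z)\<close>. The interchange needs absolute convergence of the double series, which holds
  only for small \<open>z\<close>.
\<close>

lemma Pfaff_transformation_near_0: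
  fixes a b c z :: complex
  assumes c: "c \<notin> \<int>\<^sub>\<le>\<^sub>0" and z: "norm z < 1 / 8"
  shows "hypergeometric_2F1 a b c z =
           (1 - z) powr (- b) * hypergeometric_2F1 (c - a) b c (- (z / (1 - z)))"
proof -
  define T where "T = (\<lambda>(n, j). pochhammer (c - a) n / pochhammer c n * (-1) ^ n
    * pochhammer b (n + j) / (fact n * fact j) * z ^ (n + j))"
  \<comment> \<open>A binomial coefficient (at most \<open>2\<^sup>n\<^sup>+\<^sup>j\<close>) and two Pochhammer quotients (growth rate \<open>3/2\<close> each) enter the
     bound, and with \<open>norm z < 1/8\<close> the resulting ratios are at most \<open>2 * (3/2)\<^sup>2 / 8 = 9/16\<close>.\<close>
  have r: "(3 / 2 :: real) > 1"
    by simp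
  obtain C where C: "C \<ge> 0" "\<And>n. norm (pochhammer (c - a) n / pochhammer c n) \<le> C * (3 / 2) ^ n"
    by (rule pochhammer_ratio_bound[OF c r]) (rule that)
  obtain B where B: "B \<ge> 0" "\<And>n. norm (pochhammer b n / fact n) \<le> B * (3 / 2) ^ n"
    by (rule pochhammer_over_fact_bound[OF r]) (rule that)
  have T_bound: "norm (T (n, j)) \<le> (C * B) * (9 / 16) ^ n * (9 / 16) ^ j" for n j
  proof -
    have "(fact (n + j) :: complex) = fact n * fact j * of_nat ((n + j) choose n)"
      by (simp add: binomial_fact)
    then have "T (n, j) = pochhammer (c - a) n / pochhammer c n * (-1) ^ n
        * (pochhammer b (n + j) / fact (n + j)) * of_nat ((n + j) choose n) * z ^ (n + j)"
      by (simp add: T_def)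
    then have "norm (T (n, j)) = norm (pochhammer (c - a) n / pochhammer c n)
        * norm (pochhammer b (n + j) / fact (n + j)) * real ((n + j) choose n) * norm z ^ (n + j)"
      by (simp add: norm_mult norm_divide norm_power)
    also have "\<dots> \<le> (C * (3 / 2) ^ n) * (B * (3 / 2) ^ (n + j)) * 2 ^ (n + j) * (1 / 8) ^ (n + j)"
    proof (intro mult_mono C B power_mono)
      show "real ((n + j) choose n) \<le> 2 ^ (n + j)"
        using binomial_le_pow2[of "n + j" n] by (metis of_nat_le_iff of_nat_numeral of_nat_power)
    qed (use z B(1) C(1) in auto)
    also have "\<dots> = (C * B) * (9 / 16) ^ n * (3 / 8) ^ j"
      by (simp add: power_add power_divide power_mult_distrib[symmetric] field_simps)
    also have "\<dots> \<le> (C * B) * (9 / 16) ^ n * (9 / 16) ^ j"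
      using B(1) C(1) by (intro mult_left_mono power_mono) auto
    finally show ?thesis .
  qed
  have "T summable_on UNIV \<times> UNIV"
    by (rule summable_on_geometric_bound[where C = "C * B" and p = "9 / 16" and q = "9 / 16"])
      (use T_bound B C in auto)
  then obtain S where S: "(T has_sum S) (UNIV \<times> UNIV)"
    unfolding summable_on_def by blast
  have z1: "1 - z \<noteq> 0" using z by auto
  have w: "norm (- (z / (1 - z))) < 1"
  proof -
    have "norm z < norm (1 - z)"
      using norm_triangle_ineq2[of 1 z] z by simp
    then show ?thesis using z1 by (simp add: norm_divide)
  qed
  have "((\<lambda>n. (1 - z) powr (- b) * (pochhammer (c - a) n * pochhammer b n / (pochhammer c n * fact n)
          * (- (z / (1 - z))) ^ n)) has_sum S) UNIV"
  proof (rule has_sum_SigmaD[OF S])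
    fix n :: nat
    have "((\<lambda>j. pochhammer (c - a) n * pochhammer b n / (pochhammer c n * fact n) * (- z) ^ n
            * (pochhammer (b + of_nat n) j / fact j * z ^ j)) has_sum
          pochhammer (c - a) n * pochhammer b n / (pochhammer c n * fact n) * (- z) ^ n
            * (1 - z) powr (- (b + of_nat n))) UNIV"
      using z by (intro has_sum_cmult_right has_sum_binomial_series) auto
    also have "(1 - z) powr (- (b + of_nat n)) = (1 - z) powr (- b) / (1 - z) ^ n"
      using z1 by (simp add: powr_diff powr_nat')
    finally show "((\<lambda>j. T (n, j)) has_sum (1 - z) powr (- b) *
        (pochhammer (c - a) n * pochhammer b n / (pochhammer c n * fact n) * (- (z / (1 - z))) ^ n)) UNIV"
      by (simp add: T_def pochhammer_product' power_add power_minus[of z] power_minus[of "z / (1 - z)"]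
            power_divide mult_ac)
  qed
  moreover have "((\<lambda>n. (1 - z) powr (- b) * (pochhammer (c - a) n * pochhammer b n / (pochhammer c n * fact n)
          * (- (z / (1 - z))) ^ n)) has_sum
        (1 - z) powr (- b) * hypergeometric_2F1 (c - a) b c (- (z / (1 - z)))) UNIV"
    by (intro has_sum_cmult_right has_sum_hypergeometric_2F1 c w)
  ultimately have rows: "S = (1 - z) powr (- b) * hypergeometric_2F1 (c - a) b c (- (z / (1 - z)))"
    by (rule has_sum_unique)
  have "bij_betw (\<lambda>(N, n). (n, N - n)) (SIGMA N:UNIV. {..N}) (UNIV \<times> (UNIV :: nat set))"
    by (rule bij_betwI[where g = "\<lambda>(n, j). (n + j, n)"]) auto
  from has_sum_reindex_bij_betw[OF this, of T S] S
  have diag: "((\<lambda>(N, n). T (n, N - n)) has_sum S) (SIGMA N:UNIV. {..N})"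
    by (simp add: case_prod_unfold)
  have "((\<lambda>N. pochhammer a N * pochhammer b N / (pochhammer c N * fact N) * z ^ N) has_sum S) UNIV"
  proof (rule has_sum_SigmaD[OF diag])
    fix N :: nat
    have "(\<Sum>n\<le>N. T (n, N - n)) = pochhammer b N * z ^ N *
        (\<Sum>n\<le>N. pochhammer (c - a) n / pochhammer c n * (-1) ^ n / (fact n * fact (N - n)))"
      unfolding sum_distrib_left by (intro sum.cong) (auto simp: T_def)
    also have "\<dots> = pochhammer a N * pochhammer b N / (pochhammer c N * fact N) * z ^ N"
      unfolding sum_Vandermonde_binomial[OF c] by simp
    finally show "((\<lambda>n. case (N, n) of (N, n) \<Rightarrow> T (n, N - n)) has_sum
        pochhammer a N * pochhammer b N / (pochhammer c N * fact N) * z ^ N) {..N}"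
      by (intro has_sum_finiteI) auto
  qed
  moreover have "((\<lambda>N. pochhammer a N * pochhammer b N / (pochhammer c N * fact N) * z ^ N) has_sum
      hypergeometric_2F1 a b c z) UNIV"
    using z by (intro has_sum_hypergeometric_2F1 c) auto
  ultimately have "S = hypergeometric_2F1 a b c z"
    by (rule has_sum_unique)
  with rows show ?thesis by simp
qed

text \<open>
  The points where both series in Pfaff's transformation converge thus form the intersection of a
  disc with a half-plane. It is convex, hence connected, as analytic continuation requires.
\<close>

lemma norm_Pfaff_argument_less_1_iff:
  fixes z :: complex
  assumes "z \<noteq> 1"
  shows "norm (z / (1 - z)) < 1 \<longleftrightarrow> Re z < 1 / 2"
proof -
  have "norm (z / (1 - z)) < 1 \<longleftrightarrow> norm z < norm (1 - z)"
    using assms by (simp add: norm_divide)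
  also have "\<dots> \<longleftrightarrow> Re z < 1 / 2"
    unfolding cmod_def real_sqrt_less_iff by (simp add: power2_eq_square algebra_simps)
  finally show ?thesis .
qed

text \<open>
  Both sides are holomorphic on the convex region where both series converge and agree near \<open>0\<close>,
  so they agree on the whole region. The principal power causes no trouble because \<open>1 - w\<close> has
  positive real part there.
\<close>

lemma Pfaff_transformation:
  fixes a b c z :: complex
  assumes c: "c \<notin> \<int>\<^sub>\<le>\<^sub>0" and z: "norm z < 1" "norm (z / (1 - z)) < 1"
  shows "hypergeometric_2F1 a b c z =
           (1 - z) powr (- b) * hypergeometric_2F1 (c - a) b c (- (z / (1 - z)))"
proof -
  define D where "D = ball 0 1 \<inter> {z. Re z < 1 / 2}"
  have D_iff: "w \<in> D \<longleftrightarrow> norm w < 1 \<and> norm (w / (1 - w)) < 1" for w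
  proof (cases "w = 1")
    case False
    then show ?thesis
      unfolding D_def by (simp add: norm_Pfaff_argument_less_1_iff)
  qed (simp add: D_def)
  define f where "f w = hypergeometric_2F1 a b c w
    - (1 - w) powr (- b) * hypergeometric_2F1 (c - a) b c (- (w / (1 - w)))" for w
  have "f z = 0"
  proof (rule analytic_continuation[where f = f and w = z and S = D and U = "ball 0 (1 / 8)" and \<xi> = 0])
    show "open D"
      unfolding D_def by (intro open_Int open_ball open_halfspace_Re_lt)
    show "connected D"
      unfolding D_def by (intro convex_connected convex_Int convex_ball convex_halfspace_Re_lt)
    have "1 - w \<notin> \<real>\<^sub>\<le>\<^sub>0" if "w \<in> D" for w
      using that by (auto simp: D_def complex_nonpos_Reals_iff)
    moreover have "(hypergeometric_2F1 (c - a) b c \<circ> (\<lambda>w. - (w / (1 - w)))) holomorphic_on D"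
    proof (rule holomorphic_on_compose_gen[OF _ holomorphic_hypergeometric_2F1[OF c]])
      show "(\<lambda>w. - (w / (1 - w))) holomorphic_on D"
        by (intro holomorphic_intros) (auto simp: D_def)
      show "(\<lambda>w. - (w / (1 - w))) ` D \<subseteq> ball 0 1"
        using D_iff by auto
    qed
    moreover have "hypergeometric_2F1 a b c holomorphic_on D"
      by (rule holomorphic_on_subset[OF holomorphic_hypergeometric_2F1[OF c]]) (auto simp: D_def)
    ultimately show "f holomorphic_on D"
      unfolding f_def by (auto intro!: holomorphic_intros simp: o_def)
    have "Re w < 1 / 2" if "norm w < 1 / 8" for w
      using complex_Re_le_cmod[of w] that by linarith
    then show "ball 0 (1 / 8) \<subseteq> D"
      by (auto simp: D_def)
    show "0 \<in> D"
      by (simp add: D_def)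
    show "0 islimpt ball (0::complex) (1 / 8)"
      by (simp add: islimpt_ball)
    show "f w = 0" if "w \<in> ball 0 (1 / 8)" for w
      using Pfaff_transformation_near_0[OF c, of w a b] that by (simp add: f_def)
    show "z \<in> D"
      using D_iff z by simp
  qed
  then show ?thesis
    by (simp add: f_def)
qed
section \<open>Rescaling the Appell functions to step one\<close>

lemma k_pochhammer_eq_pochhammer:
  assumes "k \<noteq> 0"
  shows "k_pochhammer k a n = of_real k ^ n * pochhammer (a / of_real k) n"
proof -
  have "of_real k ^ n * pochhammer (a / of_real k) n = (\<Prod>i<n. of_real k * (a / of_real k + of_nat i))"
    by (simp add: prod.distrib pochhammer_prod atLeast0LessThan)
  also have "\<dots> = k_pochhammer k a n"
    unfolding k_pochhammer_def using assms by (intro prod.cong) (simp_all add: field_simps)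
  finally show ?thesis ..
qed

lemma k_pochhammer_1: "k_pochhammer 1 a n = pochhammer a n"
  by (simp add: k_pochhammer_eq_pochhammer)

text \<open>
  Each term carries \<open>m + n\<close> more factors \<open>k\<close> in its numerator than in its denominator, and these
  are absorbed by \<open>x\<^sup>m y\<^sup>n\<close>. The same count applies to \<open>F\<^sub>3\<close> below.
\<close>

lemma appell_F1_rescale:
  assumes k: "k \<noteq> 0"
  shows "appell_F1 k \<alpha> \<beta> \<beta>' \<gamma> x y = appell_F1 1 (\<alpha> / of_real k) (\<beta> / of_real k)
           (\<beta>' / of_real k) (\<gamma> / of_real k) (of_real k * x) (of_real k * y)"
  unfolding appell_F1_def k_pochhammer_1 k_pochhammer_eq_pochhammer[OF k]
  by (intro infsum_cong) (use k in \<open>auto simp: power_mult_distrib power_add\<close>)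

lemma appell_F3_rescale:
  assumes k: "k \<noteq> 0"
  shows "appell_F3 k \<alpha> \<alpha>' \<beta> \<beta>' \<gamma> x y = appell_F3 1 (\<alpha> / of_real k) (\<alpha>' / of_real k)
           (\<beta> / of_real k) (\<beta>' / of_real k) (\<gamma> / of_real k) (of_real k * x) (of_real k * y)"
  unfolding appell_F3_def k_pochhammer_1 k_pochhammer_eq_pochhammer[OF k]
  by (intro infsum_cong) (use k in \<open>auto simp: power_mult_distrib power_add\<close>)

section \<open>Summation by rows\<close>

lemma add_of_nat_notin_nonpos_Ints:
  fixes c :: complex
  assumes "c \<notin> \<int>\<^sub>\<le>\<^sub>0"
  shows "c + of_nat m \<notin> \<int>\<^sub>\<le>\<^sub>0"
proof
  assume "c + of_nat m \<in> \<int>\<^sub>\<le>\<^sub>0"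
  then obtain n where "c + of_nat m = - of_nat n"
    by (rule nonpos_Ints_cases')
  then have "c + of_nat m + of_nat n = 0"
    by simp
  then have "c + of_nat (m + n) = 0"
    by (simp add: add.assoc)
  with assms plus_of_nat_eq_0_imp show False
    by blast
qed

text \<open>
  For fixed \<open>m\<close>, splitting \<open>(a)\<close> and \<open>(c)\<close> at index \<open>m\<close> leaves a Gauss series in \<open>y\<close> in which
  \<open>a\<close> and \<open>c\<close> are shifted by \<open>m\<close>. Absolute convergence of the double series allows summing by rows.
\<close>

lemma appell_F1_rows:
  fixes a b b' c x y :: complex
  assumes c: "c \<notin> \<int>\<^sub>\<le>\<^sub>0" and x: "norm x < 1" and y: "norm y < 1"
  shows "((\<lambda>m. pochhammer a m * pochhammer b m / (pochhammer c m * fact m) * x ^ m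
             * hypergeometric_2F1 (a + of_nat m) b' (c + of_nat m) y)
           has_sum appell_F1 1 a b b' c x y) UNIV"
proof -
  define T where "T = (\<lambda>(m, n). pochhammer a (m + n) * pochhammer b m * pochhammer b' n
    / pochhammer c (m + n) * (x ^ m / fact m) * (y ^ n / fact n))"
  obtain r where r: "r > 1" "r ^ 2 * max (norm x) (norm y) < 1"
    using exists_radius_power_mult_less_1[of "max (norm x) (norm y)" 2] x y by auto
  obtain A where A: "A \<ge> 0" "\<And>n. norm (pochhammer a n / pochhammer c n) \<le> A * r ^ n"
    by (rule pochhammer_ratio_bound[OF c r(1)]) (rule that)
  obtain B where B: "B \<ge> 0" "\<And>n. norm (pochhammer b n / fact n) \<le> B * r ^ n"
    by (rule pochhammer_over_fact_bound[OF r(1)]) (rule that)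
  obtain B' where B': "B' \<ge> 0" "\<And>n. norm (pochhammer b' n / fact n) \<le> B' * r ^ n"
    by (rule pochhammer_over_fact_bound[OF r(1)]) (rule that)
  have "T summable_on UNIV \<times> UNIV"
  proof (rule summable_on_geometric_bound)
    fix m n
    have "norm (T (m, n)) = norm (pochhammer a (m + n) / pochhammer c (m + n))
        * norm (pochhammer b m / fact m) * norm (pochhammer b' n / fact n) * norm x ^ m * norm y ^ n"
      by (simp add: T_def norm_mult norm_divide norm_power)
    also have "\<dots> \<le> (A * r ^ (m + n)) * (B * r ^ m) * (B' * r ^ n) * norm x ^ m * norm y ^ n"
      using A(1) B(1) B'(1) r(1) by (intro mult_mono A(2) B(2) B'(2)) auto
    finally show "norm (T (m, n)) \<le> (A * B * B') * (r ^ 2 * norm x) ^ m * (r ^ 2 * norm y) ^ n"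
      by (simp add: power_mult_distrib power_add power2_eq_square mult_ac)
  next
    have "r ^ 2 * norm x \<le> r ^ 2 * max (norm x) (norm y)"
         "r ^ 2 * norm y \<le> r ^ 2 * max (norm x) (norm y)"
      by (intro mult_left_mono; simp)+
    then show "r ^ 2 * norm x < 1" "r ^ 2 * norm y < 1"
      using r(2) by linarith+
  qed (use A(1) B(1) B'(1) in auto)
  then have "(T has_sum infsum T (UNIV \<times> UNIV)) (UNIV \<times> UNIV)"
    by (rule has_sum_infsum)
  also have "infsum T (UNIV \<times> UNIV) = appell_F1 1 a b b' c x y"
    by (simp add: appell_F1_def T_def k_pochhammer_1)
  finally show ?thesis
  proof (rule has_sum_SigmaD)
    fix m
    have "((\<lambda>n. pochhammer a m * pochhammer b m / (pochhammer c m * fact m) * x ^ m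
            * (pochhammer (a + of_nat m) n * pochhammer b' n
                / (pochhammer (c + of_nat m) n * fact n) * y ^ n))
          has_sum pochhammer a m * pochhammer b m / (pochhammer c m * fact m) * x ^ m
            * hypergeometric_2F1 (a + of_nat m) b' (c + of_nat m) y) UNIV"
      by (intro has_sum_cmult_right has_sum_hypergeometric_2F1 add_of_nat_notin_nonpos_Ints c y)
    then show "((\<lambda>n. T (m, n)) has_sum pochhammer a m * pochhammer b m / (pochhammer c m * fact m) * x ^ m
            * hypergeometric_2F1 (a + of_nat m) b' (c + of_nat m) y) UNIV"
      by (simp add: T_def pochhammer_product' mult_ac)
  qed
qed

text \<open>
  Here only the denominator parameter is shifted, because the numerator symbols of \<open>F\<^sub>3\<close> depend on
  \<open>m\<close> or on \<open>n\<close> alone. For the same reason the quotient \<open>(a)\<^sub>m (a')\<^sub>n / (c)\<^sub>m\<^sub>+\<^sub>n\<close> is compared with factorials,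
  which is harmless as \<open>m! n! / (m + n)! \<le> 1\<close>.
\<close>

lemma appell_F3_rows:
  fixes a a' b b' c x y :: complex
  assumes c: "c \<notin> \<int>\<^sub>\<le>\<^sub>0" and x: "norm x < 1" and y: "norm y < 1"
  shows "((\<lambda>m. pochhammer a m * pochhammer b m / (pochhammer c m * fact m) * x ^ m
             * hypergeometric_2F1 a' b' (c + of_nat m) y)
           has_sum appell_F3 1 a a' b b' c x y) UNIV"
proof -
  define T where "T = (\<lambda>(m, n). pochhammer a m * pochhammer a' n * pochhammer b m * pochhammer b' n
    / pochhammer c (m + n) * (x ^ m / fact m) * (y ^ n / fact n))"
  obtain r where r: "r > 1" "r ^ 3 * max (norm x) (norm y) < 1"
    using exists_radius_power_mult_less_1[of "max (norm x) (norm y)" 3] x y by auto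
  obtain D where D: "D \<ge> 0" "\<And>n. norm (pochhammer 1 n / pochhammer c n) \<le> D * r ^ n"
    by (rule pochhammer_ratio_bound[OF c r(1)]) (rule that)
  obtain A where A: "A \<ge> 0" "\<And>n. norm (pochhammer a n / fact n) \<le> A * r ^ n"
    by (rule pochhammer_over_fact_bound[OF r(1)]) (rule that)
  obtain A' where A': "A' \<ge> 0" "\<And>n. norm (pochhammer a' n / fact n) \<le> A' * r ^ n"
    by (rule pochhammer_over_fact_bound[OF r(1)]) (rule that)
  obtain B where B: "B \<ge> 0" "\<And>n. norm (pochhammer b n / fact n) \<le> B * r ^ n"
    by (rule pochhammer_over_fact_bound[OF r(1)]) (rule that)
  obtain B' where B': "B' \<ge> 0" "\<And>n. norm (pochhammer b' n / fact n) \<le> B' * r ^ n"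
    by (rule pochhammer_over_fact_bound[OF r(1)]) (rule that)
  have "T summable_on UNIV \<times> UNIV"
  proof (rule summable_on_geometric_bound)
    fix m n
    have fact_ratio: "fact m * fact n / fact (m + n) \<le> (1 :: real)"
    proof -
      have "fact m * fact n / fact (m + n) = 1 / real ((m + n) choose m)"
        by (simp add: binomial_fact)
      moreover have "real ((m + n) choose m) \<ge> 1"
        using zero_less_binomial[of m "m + n"] by linarith
      ultimately show ?thesis
        by simp
    qed
    have "norm (T (m, n)) = norm (pochhammer 1 (m + n) / pochhammer c (m + n))
        * norm (pochhammer a m / fact m) * norm (pochhammer a' n / fact n)
        * norm (pochhammer b m / fact m) * norm (pochhammer b' n / fact n)
        * (fact m * fact n / fact (m + n)) * norm x ^ m * norm y ^ n"
      by (simp add: T_def norm_mult norm_divide norm_power flip: pochhammer_fact)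
    also have "\<dots> \<le> (D * r ^ (m + n)) * (A * r ^ m) * (A' * r ^ n) * (B * r ^ m) * (B' * r ^ n)
        * 1 * norm x ^ m * norm y ^ n"
      using D(1) A(1) A'(1) B(1) B'(1) r(1)
      by (intro mult_mono D(2) A(2) A'(2) B(2) B'(2) fact_ratio) auto
    finally show "norm (T (m, n)) \<le> (D * A * A' * B * B') * (r ^ 3 * norm x) ^ m * (r ^ 3 * norm y) ^ n"
      by (simp add: power_mult_distrib power_add power3_eq_cube mult_ac)
  next
    have "r ^ 3 * norm x \<le> r ^ 3 * max (norm x) (norm y)"
         "r ^ 3 * norm y \<le> r ^ 3 * max (norm x) (norm y)"
      using r(1) by (intro mult_left_mono; simp)+
    then show "r ^ 3 * norm x < 1" "r ^ 3 * norm y < 1"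
      using r(2) by linarith+
  qed (use r(1) D(1) A(1) A'(1) B(1) B'(1) in auto)
  then have "(T has_sum infsum T (UNIV \<times> UNIV)) (UNIV \<times> UNIV)"
    by (rule has_sum_infsum)
  also have "infsum T (UNIV \<times> UNIV) = appell_F3 1 a a' b b' c x y"
    by (simp add: appell_F3_def T_def k_pochhammer_1)
  finally show ?thesis
  proof (rule has_sum_SigmaD)
    fix m
    have "((\<lambda>n. pochhammer a m * pochhammer b m / (pochhammer c m * fact m) * x ^ m
            * (pochhammer a' n * pochhammer b' n / (pochhammer (c + of_nat m) n * fact n) * y ^ n))
          has_sum pochhammer a m * pochhammer b m / (pochhammer c m * fact m) * x ^ m
            * hypergeometric_2F1 a' b' (c + of_nat m) y) UNIV"
      by (intro has_sum_cmult_right has_sum_hypergeometric_2F1 add_of_nat_notin_nonpos_Ints c y)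
    then show "((\<lambda>n. T (m, n)) has_sum pochhammer a m * pochhammer b m / (pochhammer c m * fact m) * x ^ m
            * hypergeometric_2F1 a' b' (c + of_nat m) y) UNIV"
      by (simp add: T_def pochhammer_product' mult_ac)
  qed
qed

text \<open>
  The difference of the shifted parameters, \<open>(c + m) - (a + m) = c - a\<close>, does not depend on \<open>m\<close>.
  Therefore Pfaff's transformation takes row \<open>m\<close> of \<open>F\<^sub>1\<close> exactly to row \<open>m\<close> of \<open>F\<^sub>3\<close>, with the same
  prefactor for every row.
\<close>

lemma appell_F1_eq_appell_F3_unscaled:
  fixes a b b' c x y :: complex
  assumes c: "c \<notin> \<int>\<^sub>\<le>\<^sub>0" and x: "norm x < 1" and y: "norm y < 1" "norm (y / (1 - y)) < 1"
  shows "appell_F1 1 a b b' c x y =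
           (1 - y) powr (- b') * appell_F3 1 a (c - a) b b' c x (- (y / (1 - y)))"
proof -
  let ?row = "\<lambda>m. pochhammer a m * pochhammer b m / (pochhammer c m * fact m) * x ^ m"
  let ?w = "- (y / (1 - y))"
  have "((\<lambda>m. (1 - y) powr (- b') * (?row m * hypergeometric_2F1 (c - a) b' (c + of_nat m) ?w))
      has_sum (1 - y) powr (- b') * appell_F3 1 a (c - a) b b' c x ?w) UNIV"
    using c x y(2) by (intro has_sum_cmult_right appell_F3_rows) auto
  moreover have "(1 - y) powr (- b') * (?row m * hypergeometric_2F1 (c - a) b' (c + of_nat m) ?w)
      = ?row m * hypergeometric_2F1 (a + of_nat m) b' (c + of_nat m) y" for m
    using Pfaff_transformation[OF add_of_nat_notin_nonpos_Ints[OF c, of m] y, of "a + of_nat m" b']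
    by (simp add: mult_ac)
  ultimately have "((\<lambda>m. ?row m * hypergeometric_2F1 (a + of_nat m) b' (c + of_nat m) y)
      has_sum (1 - y) powr (- b') * appell_F3 1 a (c - a) b b' c x ?w) UNIV"
    by (simp only:)
  with appell_F1_rows[OF c x y(1)] show ?thesis
    by (rule has_sum_unique)
qed

theorem theorem14:
  fixes k :: real and \<alpha> \<beta> \<beta>' \<gamma> x y :: complex
  assumes "k > 0"
    and "\<And>j::nat. \<gamma> \<noteq> - (of_nat j * of_real k)"
    and "norm x < 1 / k" and "norm y < 1 / k"
    and "norm (y / (1 - of_real k * y)) < 1 / k"
  shows "appell_F1 k \<alpha> \<beta> \<beta>' \<gamma> x y =
           (1 - of_real k * y) powr (- (\<beta>' / of_real k)) *
           appell_F3 k \<alpha> (\<gamma> - \<alpha>) \<beta> \<beta>' \<gamma> x (- (y / (1 - of_real k * y)))"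
proof -
  have k: "k \<noteq> 0"
    using assms(1) by simp
  have "\<gamma> / of_real k \<notin> \<int>\<^sub>\<le>\<^sub>0"
  proof
    assume "\<gamma> / of_real k \<in> \<int>\<^sub>\<le>\<^sub>0"
    then obtain j where "\<gamma> / of_real k = - of_nat j"
      by (rule nonpos_Ints_cases')
    then show False
      using k assms(2)[of j] by (simp add: field_simps)
  qed
  moreover have "norm (of_real k * x) < 1" "norm (of_real k * y) < 1"
      "norm (of_real k * y / (1 - of_real k * y)) < 1"
    using assms(1,3,4,5) by (simp_all add: norm_mult norm_divide field_simps)
  ultimately have "appell_F1 1 (\<alpha> / of_real k) (\<beta> / of_real k) (\<beta>' / of_real k) (\<gamma> / of_real k)
        (of_real k * x) (of_real k * y)
      = (1 - of_real k * y) powr (- (\<beta>' / of_real k))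
        * appell_F3 1 (\<alpha> / of_real k) (\<gamma> / of_real k - \<alpha> / of_real k) (\<beta> / of_real k) (\<beta>' / of_real k)
            (\<gamma> / of_real k) (of_real k * x) (- (of_real k * y / (1 - of_real k * y)))"
    by (rule appell_F1_eq_appell_F3_unscaled)
  then show ?thesis
    unfolding appell_F1_rescale[OF k] appell_F3_rescale[OF k] by (simp add: diff_divide_distrib)
qed

end
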